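(* Let $M$ be a closed submonoid of $\mathbf O^{(1)}$. Suppose that $M$ contains a submonoid $N$ such that (1) $N$ is not closed in $M$; (2) composing any element of $M$ with an element of $M$ outside $N$ yields an element outside $N$, i.e. for all $f\in M$ and $g\in M\setminus N$ we have $f\circ g\notin N$ and $g\circ f\notin N$. Then $M$ does not have automatic continuity.
   Context: $\mathbf O^{(1)}$ is the monoid of all functions from a countably infinite set $D$ to itself under composition, with the topology of pointwise convergence ($D$ discrete). Submonoids contain the identity function and carry the subspace topology; "closed submonoid" means closed in $\mathbf O^{(1)}$. A closed submonoid $M$ of $\mathbf O^{(1)}$ has automatic continuity if every monoid homomorphism from $M$ into $\mathbf O^{(1)}$ is continuous. *)

theory Defs
  imports "HOL-Analysis.Analysis" "HOL-Algebra.Group"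
begin

(* Functions D -> D are represented by their extensional representatives, as in the library's
   BijGroup; the product x * y is the composition "x after y". *)
definition full_transf_monoid :: "'a set \<Rightarrow> ('a \<Rightarrow> 'a) monoid" where
  "full_transf_monoid D =
     \<lparr>carrier = D \<rightarrow>\<^sub>E D, mult = compose D, one = (\<lambda>x\<in>D. x)\<rparr>"

definition pointwise_topology :: "'a set \<Rightarrow> ('a \<Rightarrow> 'a) topology" where
  "pointwise_topology D = product_topology (\<lambda>_. discrete_topology D) D"

(* The library's hom only asks for compatibility with the multiplication, so preservation of the
   identity is required separately. *)
definition monoid_homs :: "('a, 'm) monoid_scheme \<Rightarrow> ('b, 'n) monoid_scheme \<Rightarrow> ('a \<Rightarrow> 'b) set" where
  "monoid_homs G H = {h \<in> hom G H. h \<one>\<^bsub>G\<^esub> = \<one>\<^bsub>H\<^esub>}"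

definition automatic_continuity :: "'a set \<Rightarrow> ('a \<Rightarrow> 'a) set \<Rightarrow> bool" where
  "automatic_continuity D M \<longleftrightarrow>
     (\<forall>\<phi> \<in> monoid_homs (full_transf_monoid D\<lparr>carrier := M\<rparr>) (full_transf_monoid D).
        continuous_map (subtopology (pointwise_topology D) M) (pointwise_topology D) \<phi>)"

lemma monoid_full_transf_monoid: "monoid (full_transf_monoid D)"
  by (rule monoidI)
    (auto simp: full_transf_monoid_def compose_def PiE_iff extensional_def fun_eq_iff)

lemma topspace_pointwise_topology:
  "topspace (pointwise_topology D) = carrier (full_transf_monoid D)"
  by (simp add: pointwise_topology_def full_transf_monoid_def)

end

theory Submission
  imports Defs
begin

text \<open>The hypothesis on products says that M - N is a two-sided ideal of M. Hence collapsing N to 1 and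
  the complement to 0 is a homomorphism from M into the multiplicative monoid {0, 1}. That monoid
  embeds into the transformations of D as the identity and a constant map, since constant maps are
  idempotent. The two maps are separated by the closed condition of fixing a point b other than
  the constant value. If the composite homomorphism were continuous, N would be the preimage of a
  closed set, hence closed in M.\<close>

text \<open>A product of elements of M lies in N exactly if both factors do: one direction is closure of
  N under products, the other is the ideal property of the complement. Mapping the complement to
  an idempotent of any monoid is therefore multiplicative.\<close>

lemma collapse_complement_hom:
  assumes N: "submonoid N G" and "N \<subseteq> M"
    and ideal: "\<And>f g. f \<in> M \<Longrightarrow> g \<in> M - N \<Longrightarrow> f \<otimes>\<^bsub>G\<^esub> g \<notin> N \<and> g \<otimes>\<^bsub>G\<^esub> f \<notin> N"
    and H: "monoid H" and e: "e \<in> carrier H" "e \<otimes>\<^bsub>H\<^esub> e = e"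
  shows "(\<lambda>f. if f \<in> N then \<one>\<^bsub>H\<^esub> else e) \<in> monoid_homs (G\<lparr>carrier := M\<rparr>) H"
proof -
  interpret H: monoid H by (rule H)
  have "f \<otimes>\<^bsub>G\<^esub> g \<in> N \<longleftrightarrow> f \<in> N \<and> g \<in> N" if "f \<in> M" "g \<in> M" for f g
    using that ideal submonoid.m_closed[OF N] by blast
  then show ?thesis
    using e submonoid.one_closed[OF N] by (auto simp: monoid_homs_def hom_def)
qed

lemma closedin_fixing_point:
  assumes "b \<in> D"
  shows "closedin (pointwise_topology D) {h \<in> topspace (pointwise_topology D). h b = b}"
proof -
  have "continuous_map (pointwise_topology D) (discrete_topology D) (\<lambda>h. h b)"
    unfolding pointwise_topology_def using assms by (rule continuous_map_product_projection)
  moreover have "closedin (discrete_topology D) {b}"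
    using assms by simp
  ultimately have "closedin (pointwise_topology D)
                     {h \<in> topspace (pointwise_topology D). h b \<in> {b}}"
    by (rule closedin_continuous_map_preimage)
  then show ?thesis
    by simp
qed

theorem proposition9:
  fixes D :: "'a set" and M N :: "('a \<Rightarrow> 'a) set"
  assumes "countable D" and "infinite D"
    and "submonoid M (full_transf_monoid D)"
    and "closedin (pointwise_topology D) M"
    and "submonoid N (full_transf_monoid D)" and "N \<subseteq> M"
    and "\<not> closedin (subtopology (pointwise_topology D) M) N"
    and "\<And>f g. f \<in> M \<Longrightarrow> g \<in> M - N \<Longrightarrow>
           f \<otimes>\<^bsub>full_transf_monoid D\<^esub> g \<notin> N \<and> g \<otimes>\<^bsub>full_transf_monoid D\<^esub> f \<notin> N"
  shows "\<not> automatic_continuity D M"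
proof
  let ?T = "full_transf_monoid D"
  let ?X = "subtopology (pointwise_topology D) M"
  assume auto_cont: "automatic_continuity D M"
  obtain a where a: "a \<in> D"
    using infinite_imp_nonempty[OF \<open>infinite D\<close>] by blast
  obtain b where b: "b \<in> D" "b \<noteq> a"
    using infinite_imp_nonempty[OF infinite_remove[OF \<open>infinite D\<close>, of a]] by blast
  define c where "c = (\<lambda>x\<in>D. a)"
  define \<phi> where "\<phi> = (\<lambda>f. if f \<in> N then \<one>\<^bsub>?T\<^esub> else c)"
  have "c \<in> carrier ?T" "c \<otimes>\<^bsub>?T\<^esub> c = c"
    using a by (auto simp: c_def full_transf_monoid_def compose_def)
  then have "\<phi> \<in> monoid_homs (?T\<lparr>carrier := M\<rparr>) ?T"
    unfolding \<phi>_def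
    using collapse_complement_hom[OF assms(5,6,8) monoid_full_transf_monoid] by blast
  then have cont: "continuous_map ?X (pointwise_topology D) \<phi>"
    using auto_cont unfolding automatic_continuity_def by blast
  have top: "topspace ?X = M"
    using closedin_subset[OF assms(4)] by auto
  have closed: "closedin ?X
          {f \<in> M. \<phi> f \<in> {h \<in> topspace (pointwise_topology D). h b = b}}"
    using closedin_continuous_map_preimage[OF cont closedin_fixing_point[OF b(1)]]
    unfolding top .
  moreover have "\<phi> f b = b \<longleftrightarrow> f \<in> N" for f
    using b by (auto simp: \<phi>_def c_def full_transf_monoid_def)
  moreover have "\<phi> f \<in> topspace (pointwise_topology D)" if "f \<in> M" for f
    using continuous_map_image_subset_topspace[OF cont] that top by blast
  ultimately have
    "{f \<in> M. \<phi> f \<in> {h \<in> topspace (pointwise_topology D). h b = b}} = N"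
    using \<open>N \<subseteq> M\<close> by blast
  then show False
    using assms(7) closed by simp
qed

end
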